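(* Let $\Phi$ be an $I$-admissible function and let $\langle X_u:u\in2^{<\omega}\rangle$ be a $\Phi$-fusion sequence. Then $X=\bigcap_{m\in\omega}\bigcup_{u\in2^m}X_u$ belongs to $\mathbb P$.
   Context: Fix a countable partially ordered set $I$. $\mathcal D=2^\omega$. For $\xi\subseteq I$, $\mathcal D^\xi$ is the product of $\xi$ copies of $\mathcal D$ with the product topology; points are functions $x:\xi\to\mathcal D$. For $\xi\subseteq\eta\subseteq I$, $x\in\mathcal D^\eta$, $X\subseteq\mathcal D^\eta$: $x\restriction\xi$ is the restriction, $X\restriction\xi=\{x\restriction\xi:x\in X\}$. $\mathrm{IS}$ is the set of initial (downward closed) subsets of $I$. For $i\in I$: $[<i]=\{j:j<i\}$, $[\le i]=\{j:j\le i\}$, $[\not\ge i]=\{j\in I:\neg(j\ge i)\}$; $X\restriction_{<i}$ means $X\restriction[<i]$, etc. For $i\in\xi\in\mathrm{IS}$, $X\subseteq\mathcal D^\xi$, $z\in X\restriction_{<i}$: $D_{Xz}(i)=\{x(i):x\in X,\ x\restriction_{<i}=z\}$. For $\zeta\in\mathrm{IS}$, $\mathbb P'_\zeta$ is the set of all $X\subseteq\mathcal D^\zeta$ such that: (P1) $X$ closed nonempty; (P2) for $i\in\zeta$, $z\in X\restriction_{<i}$, $D_{Xz}(i)$ is perfect; (P3) for $i\in\zeta$ and open $G\subseteq\mathcal D$, $\{x\restriction_{<i}:x\in X,x(i)\in G\}$ is open in $X\restriction_{<i}$; (P4) if $\xi,\eta\in\mathrm{IS}$, $\xi\cup\eta\subseteq\zeta$,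 $x\in X\restriction\xi$, $y\in X\restriction\eta$, $x\restriction(\xi\cap\eta)=y\restriction(\xi\cap\eta)$, then $x\cup y\in X\restriction(\xi\cup\eta)$. For $A\subseteq\mathcal D$ with at least two points, let $l$ be the length of the longest finite binary sequence that is an initial segment of all $a\in A$, and $\mathrm{Spl}(A,e)=\{a\in A:a(l)=e\}$. For $X\in\mathbb P'_\zeta$, $i\in\zeta$: $\mathrm{Spl}(X,i,e)=\{x\in X:x(i)\in\mathrm{Spl}(D_{X,x\restriction_{<i}}(i),e)\}$. A $\zeta$-admissible function is $\Phi:\omega\to\zeta$ taking each value in $\zeta$ infinitely often. $X_\Phi[\Lambda]=X$, $X_\Phi[u^\frown e]=\mathrm{Spl}(X_\Phi[u],\Phi(m),e)$ for $u\in2^m$; $X_\Phi[a]=\bigcap_mX_\Phi[a\restriction m]$ for $a\in2^\omega$. $X\in\mathbb P'_\zeta$ is shrinkable if every $X_\Phi[a]$ ($\Phi$ $\zeta$-admissible, $a\in2^\omega$) is a singleton; $\mathbb P_\zeta$ is the set of shrinkable members of $\mathbb P'_\zeta$, and $\mathbb P=\mathbb P_I$. For an $I$-admissible $\Phi$ and $u,v\in2^m$, define $\xi_\Phi[u,v]\in\mathrm{IS}$ by induction: $\xi[\Lambda,\Lambda]=I$; $\xi[u^\frown d,v^\frown e]=\xi[u,v]$ if $d=e$; $\xi[u^\frown d,v^\frown e]=\xi[u,v]\cap[\not\ge\Phi(n)]$ if $d\ne e$ and $u,v\in2^n$. A $\Phi$-splitting system of order $m$ is a family $\langle X_u:u\in2^{\le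 m}\rangle$ of sets $X_u\in\mathbb P$ such that: (S1) $X_{u^\frown e}\subseteq\mathrm{Spl}(X_u,\Phi(n),e)$ for $u\in2^n$, $n<m$, $e\in\{0,1\}$; (S2) $X_u\restriction\xi[u,v]=X_v\restriction\xi[u,v]$ for $u,v$ of equal length $\le m$; (S3) if $i\notin\xi[u,v]$ then $X_u\restriction_{\le i}\cap X_v\restriction_{\le i}=\emptyset$. A $\Phi$-fusion sequence is a family $\langle X_u:u\in2^{<\omega}\rangle$ of sets in $\mathbb P$ such that for every $m$ the subfamily $\langle X_u:u\in2^{\le m}\rangle$ is a $\Phi$-splitting system of order $m$, and (S4) for every $\varepsilon>0$ there is $m$ with $\mathrm{diam}\,X_u<\varepsilon$ for all $u\in2^m$ (with respect to a fixed compatible complete metric on $\mathcal D^I$). *)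

theory Defs
  imports "HOL-Analysis.Analysis"
begin

text \<open>
  The index poset \<open>I\<close> is the universe of a type of class \<open>{order, countable}\<close>.  The Cantor space is
  \<open>nat \<Rightarrow> bool\<close>; as \<open>bool\<close> is an instance of \<open>discrete_topology\<close>, its type-class topology is
  the product topology.  A point of \<open>D\<^sup>\<xi>\<close> is a function that is \<open>undefined\<close> outside \<open>\<xi>\<close>
  (so \<open>D\<^sup>I\<close> is the whole function type); \<open>restrict\<close> is then the restriction map.
\<close>

type_synonym cantor = "nat \<Rightarrow> bool"

definition pow_top :: "'i set \<Rightarrow> ('i \<Rightarrow> cantor) topology" where
  "pow_top \<xi> = product_topology (\<lambda>_. euclidean) \<xi>"

definition proj :: "('i \<Rightarrow> cantor) set \<Rightarrow> 'i set \<Rightarrow> ('i \<Rightarrow> cantor) set" where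
  "proj X \<xi> = (\<lambda>x. restrict x \<xi>) ` X"

definition IS :: "'i::order set set" where
  "IS = {\<xi>. \<forall>i\<in>\<xi>. \<forall>j\<le>i. j \<in> \<xi>}"

definition section_at :: "('i::order \<Rightarrow> cantor) set \<Rightarrow> ('i \<Rightarrow> cantor) \<Rightarrow> 'i \<Rightarrow> cantor set" where
  "section_at X z i = {x i | x. x \<in> X \<and> restrict x {..<i} = z}"

text \<open>
  Nonemptiness is not included: \<open>perfect\<close> is only applied to \<open>section_at X z i\<close> with
  \<open>z \<in> proj X {..<i}\<close>, which is nonempty.
\<close>

definition perfect :: "'a::topological_space set \<Rightarrow> bool" where
  "perfect A \<longleftrightarrow> closed A \<and> (\<forall>a\<in>A. a islimpt A)"

definition Pprime :: "'i::order set \<Rightarrow> ('i \<Rightarrow> cantor) set set" where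
  "Pprime \<zeta> = {X.
     closedin (pow_top \<zeta>) X \<and> X \<noteq> {} \<and>
     (\<forall>i\<in>\<zeta>. \<forall>z\<in>proj X {..<i}. perfect (section_at X z i)) \<and>
     (\<forall>i\<in>\<zeta>. \<forall>G. open G \<longrightarrow>
        openin (subtopology (pow_top {..<i}) (proj X {..<i}))
          {restrict x {..<i} | x. x \<in> X \<and> x i \<in> G}) \<and>
     (\<forall>\<xi>\<in>IS. \<forall>\<eta>\<in>IS. \<xi> \<union> \<eta> \<subseteq> \<zeta> \<longrightarrow>
        (\<forall>x\<in>proj X \<xi>. \<forall>y\<in>proj X \<eta>.
           restrict x (\<xi> \<inter> \<eta>) = restrict y (\<xi> \<inter> \<eta>) \<longrightarrow>
             merge \<xi> \<eta> (x, y) \<in> proj X (\<xi> \<union> \<eta>)))}"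

text \<open>
  \<open>stem_length A\<close> is meaningful only if \<open>A\<close> has at least two points; otherwise the lengths are
  unbounded and \<open>GREATEST\<close> is unspecified.
\<close>

definition stem_length :: "cantor set \<Rightarrow> nat" where
  "stem_length A = (GREATEST n. \<exists>s :: bool list. length s = n \<and> (\<forall>a\<in>A. map a [0..<n] = s))"

definition Spl_set :: "cantor set \<Rightarrow> bool \<Rightarrow> cantor set" where
  "Spl_set A e = {a \<in> A. a (stem_length A) = e}"

definition Spl :: "('i::order \<Rightarrow> cantor) set \<Rightarrow> 'i \<Rightarrow> bool \<Rightarrow> ('i \<Rightarrow> cantor) set" where
  "Spl X i e = {x \<in> X. x i \<in> Spl_set (section_at X (restrict x {..<i}) i) e}"

definition admissible :: "'i set \<Rightarrow> (nat \<Rightarrow> 'i) \<Rightarrow> bool" where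
  "admissible \<zeta> \<Phi> \<longleftrightarrow> range \<Phi> \<subseteq> \<zeta> \<and> (\<forall>i\<in>\<zeta>. infinite {n. \<Phi> n = i})"

text \<open>
  Finite binary sequences are lists, and \<open>u\<close> extended by \<open>e\<close> is \<open>u @ [e]\<close>.  Recursion is on the
  last entry, hence the auxiliary functions on reversed lists; the intended recursion equations
  are the simplification rules that follow each definition.
\<close>

primrec split_iter_rev ::
  "(nat \<Rightarrow> 'i::order) \<Rightarrow> ('i \<Rightarrow> cantor) set \<Rightarrow> bool list \<Rightarrow> ('i \<Rightarrow> cantor) set" where
  "split_iter_rev \<Phi> X [] = X"
| "split_iter_rev \<Phi> X (e # u) = Spl (split_iter_rev \<Phi> X u) (\<Phi> (length u)) e"

definition split_iter ::
  "(nat \<Rightarrow> 'i::order) \<Rightarrow> ('i \<Rightarrow> cantor) set \<Rightarrow> bool list \<Rightarrow> ('i \<Rightarrow> cantor) set" where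
  "split_iter \<Phi> X u = split_iter_rev \<Phi> X (rev u)"

lemma split_iter_Nil [simp]: "split_iter \<Phi> X [] = X"
  and split_iter_snoc [simp]: "split_iter \<Phi> X (u @ [e]) = Spl (split_iter \<Phi> X u) (\<Phi> (length u)) e"
  by (simp_all add: split_iter_def)

definition split_branch ::
  "(nat \<Rightarrow> 'i::order) \<Rightarrow> ('i \<Rightarrow> cantor) set \<Rightarrow> cantor \<Rightarrow> ('i \<Rightarrow> cantor) set" where
  "split_branch \<Phi> X a = (\<Inter>m. split_iter \<Phi> X (map a [0..<m]))"

definition shrinkable :: "'i::order set \<Rightarrow> ('i \<Rightarrow> cantor) set \<Rightarrow> bool" where
  "shrinkable \<zeta> X \<longleftrightarrow> (\<forall>\<Phi> a. admissible \<zeta> \<Phi> \<longrightarrow> is_singleton (split_branch \<Phi> X a))"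

definition PP :: "'i::order set \<Rightarrow> ('i \<Rightarrow> cantor) set set" where
  "PP \<zeta> = {X \<in> Pprime \<zeta>. shrinkable \<zeta> X}"

text \<open>\<open>xi \<Phi> u v\<close> is meaningful only for \<open>u\<close> and \<open>v\<close> of equal length.\<close>

fun xi_rev :: "(nat \<Rightarrow> 'i::order) \<Rightarrow> bool list \<Rightarrow> bool list \<Rightarrow> 'i set" where
  "xi_rev \<Phi> (d # u) (e # v) =
     (if d = e then xi_rev \<Phi> u v else xi_rev \<Phi> u v \<inter> {j. \<not> j \<ge> \<Phi> (length u)})"
| "xi_rev \<Phi> _ _ = UNIV"

definition xi :: "(nat \<Rightarrow> 'i::order) \<Rightarrow> bool list \<Rightarrow> bool list \<Rightarrow> 'i set" where
  "xi \<Phi> u v = xi_rev \<Phi> (rev u) (rev v)"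

lemma xi_Nil [simp]: "xi \<Phi> [] [] = UNIV"
  and xi_snoc [simp]: "xi \<Phi> (u @ [d]) (v @ [e]) =
    (if d = e then xi \<Phi> u v else xi \<Phi> u v \<inter> {j. \<not> j \<ge> \<Phi> (length u)})"
  by (simp_all add: xi_def)

definition splitting_system ::
  "(nat \<Rightarrow> 'i::order) \<Rightarrow> nat \<Rightarrow> (bool list \<Rightarrow> ('i \<Rightarrow> cantor) set) \<Rightarrow> bool" where
  "splitting_system \<Phi> m X \<longleftrightarrow>
     (\<forall>u. length u \<le> m \<longrightarrow> X u \<in> PP UNIV) \<and>
     (\<forall>u e. length u < m \<longrightarrow> X (u @ [e]) \<subseteq> Spl (X u) (\<Phi> (length u)) e) \<and>
     (\<forall>u v. length u = length v \<and> length u \<le> m \<longrightarrow>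
        proj (X u) (xi \<Phi> u v) = proj (X v) (xi \<Phi> u v)) \<and>
     (\<forall>u v i. length u = length v \<and> length u \<le> m \<and> i \<notin> xi \<Phi> u v \<longrightarrow>
        proj (X u) {..i} \<inter> proj (X v) {..i} = {})"

text \<open>
  The supremum is a genuine one whenever \<open>A\<close> is nonempty and bounded, as for nonempty subsets of
  the compact space \<open>D\<^sup>I\<close>.
\<close>

definition diam :: "'a metric \<Rightarrow> 'a set \<Rightarrow> real" where
  "diam M A = (SUP (x, y) \<in> A \<times> A. mdist M x y)"

definition fusion_sequence ::
  "('i::order \<Rightarrow> cantor) metric \<Rightarrow> (nat \<Rightarrow> 'i) \<Rightarrow> (bool list \<Rightarrow> ('i \<Rightarrow> cantor) set) \<Rightarrow> bool" where
  "fusion_sequence M \<Phi> X \<longleftrightarrow>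
     (\<forall>m. splitting_system \<Phi> m X) \<and>
     (\<forall>\<epsilon>>0. \<exists>m. \<forall>u. length u = m \<longrightarrow> diam M (X u) < \<epsilon>)"

end

theory Submission
  imports Defs
begin

text \<open>
  Every branch \<open>a\<close> determines a point \<open>x a\<close>, the unique element of \<open>\<Inter>m. X (a restricted to m)\<close>,
  and the fusion set is the range of \<open>x\<close>.  By (S2) and (S3) the restriction of \<open>x a\<close> to an initial
  set \<open>\<xi>\<close> determines, and is determined by, the bits \<open>a n\<close> with \<open>\<Phi> n \<in> \<xi>\<close>.  So \<open>x\<close> is a
  projection-keeping embedding of the Cantor space, regarded as \<open>D\<^sup>I\<close> by means of \<open>\<Phi>\<close>, and (P1)-(P4)
  are transferred from \<open>D\<^sup>I\<close> to its range.

  By (S1) the splitting of the range along \<open>\<Phi>\<close> reads the bits of \<open>a\<close> one after the other.  The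
  sections at \<open>i\<close> are affected only by the splittings at \<open>i\<close>, so splitting along another admissible
  \<open>\<Psi>\<close> reads the same bits in the order given by the bijection \<open>\<tau>\<close> with \<open>\<Phi> \<circ> \<tau> = \<Psi>\<close> that is
  increasing on each fibre of \<open>\<Psi>\<close>; in the limit all bits are fixed.
\<close>

section \<open>Cantor space\<close>

text \<open>Tychonoff; applied with factor \<open>bool\<close> for the Cantor space and with factor
  \<open>cantor\<close> for \<open>D^I\<close>.\<close>

lemma compact_UNIV_fun:
  assumes "compact (UNIV :: 'b::topological_space set)"
  shows "compact (UNIV :: ('a \<Rightarrow> 'b) set)"
proof -
  have "compact_space (product_topology (\<lambda>_. euclidean :: 'b topology) (UNIV :: 'a set))"
    unfolding compact_space_product_topology using assms by (simp add: compact_space_def)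
  then show ?thesis
    by (simp add: euclidean_product_topology compact_space_def)
qed

lemma compact_UNIV_cantor: "compact (UNIV :: cantor set)"
  by (rule compact_UNIV_fun) (simp add: finite_imp_compact)

lemma pow_top_UNIV: "pow_top UNIV = euclidean"
  by (simp add: pow_top_def euclidean_product_topology)

lemma Hausdorff_space_cantor: "Hausdorff_space (euclidean :: cantor topology)"
proof -
  have "Hausdorff_space (euclidean :: bool topology)"
    unfolding Hausdorff_space_def
  proof (intro allI impI)
    fix p q :: bool assume "p \<in> topspace euclidean \<and> q \<in> topspace euclidean \<and> p \<noteq> q"
    then show "\<exists>U V. openin euclidean U \<and> openin euclidean V \<and> p \<in> U \<and> q \<in> V \<and> disjnt U V"
      by (intro exI[of _ "{p}"] exI[of _ "{q}"]) (simp add: open_discrete)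
  qed
  then have "Hausdorff_space (product_topology (\<lambda>_. euclidean :: bool topology) (UNIV :: nat set))"
    by (simp add: Hausdorff_space_product_topology)
  then show ?thesis by (simp add: euclidean_product_topology)
qed

text \<open>Makes compact images closed, in \<open>D^I\<close> for (P1) and in the powers over
  \<open>{..<i}\<close> for (P3).\<close>

lemma Hausdorff_space_pow_top: "Hausdorff_space (pow_top \<xi>)"
  unfolding pow_top_def Hausdorff_space_product_topology
  by (simp add: Hausdorff_space_cantor)

lemma compact_imp_closed_cantor: "compact A \<Longrightarrow> closed A" for A :: "cantor set"
  using compactin_imp_closedin[OF Hausdorff_space_cantor, of A] by simp

lemma continuous_on_cantor_coordinate: "continuous_on UNIV (\<lambda>a :: cantor. a n)"
  by (rule continuous_on_product_coordinates)

lemma open_cantor_coordinate: "open {a :: cantor. a n = e}"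
proof -
  have "open ((\<lambda>a :: cantor. a n) -` {e})"
    by (intro open_vimage continuous_on_cantor_coordinate open_discrete)
  then show ?thesis by (simp add: vimage_def)
qed

lemma open_cylinder: "open {a :: cantor. \<forall>n<m. a n = b n}"
proof -
  have "open (\<Inter>n\<in>{..<m}. {a :: cantor. a n = b n})"
    by (intro open_INT ballI open_cantor_coordinate) simp
  also have "(\<Inter>n\<in>{..<m}. {a :: cantor. a n = b n}) = {a. \<forall>n<m. a n = b n}"
    by auto
  finally show ?thesis .
qed

text \<open>A basic open set restricts only finitely many coordinates, and \<open>m\<close> bounds
  them.\<close>

lemma open_contains_cylinder:
  fixes V :: "cantor set"
  assumes "open V" "b \<in> V"
  obtains m where "{a. \<forall>n<m. a n = b n} \<subseteq> V"
proof -
  have "openin (product_topology (\<lambda>_. euclidean :: bool topology) UNIV) V"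
    using assms by (simp add: euclidean_product_topology)
  from product_topology_open_contains_basis[OF this assms(2)]
  obtain W where W: "b \<in> (\<Pi>\<^sub>E n\<in>UNIV. W n)" "finite {n. W n \<noteq> UNIV}" "(\<Pi>\<^sub>E n\<in>UNIV. W n) \<subseteq> V"
    by auto
  from W(2) obtain m where m: "\<forall>n\<in>{n. W n \<noteq> UNIV}. n < m"
    unfolding finite_nat_set_iff_bounded by (rule exE)
  have "{a. \<forall>n<m. a n = b n} \<subseteq> (\<Pi>\<^sub>E n\<in>UNIV. W n)"
  proof
    fix a assume a: "a \<in> {a. \<forall>n<m. a n = b n}"
    have "a n \<in> W n" for n
    proof (cases "n < m")
      case True
      with a W(1) show ?thesis by (simp add: PiE_UNIV_domain Pi_iff)
    next
      case False
      with m have "W n = UNIV" by auto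
      then show ?thesis by simp
    qed
    then show "a \<in> (\<Pi>\<^sub>E n\<in>UNIV. W n)" by auto
  qed
  from subset_trans[OF this W(3)] show ?thesis by (rule that)
qed

section \<open>Stems of sets in the Cantor space\<close>

lemma stem_length_alt:
  "stem_length A = (GREATEST n. \<forall>p\<in>A. \<forall>q\<in>A. \<forall>k<n. p k = q k)"
proof -
  have "(\<exists>s :: bool list. length s = n \<and> (\<forall>a\<in>A. map a [0..<n] = s)) \<longleftrightarrow>
      (\<forall>p\<in>A. \<forall>q\<in>A. \<forall>k<n. p k = q k)" for n
  proof
    assume "\<exists>s :: bool list. length s = n \<and> (\<forall>a\<in>A. map a [0..<n] = s)"
    then obtain s where s: "\<And>a. a \<in> A \<Longrightarrow> map a [0..<n] = s" by blast
    have "p k = q k" if "p \<in> A" "q \<in> A" "k < n" for p q k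
      using arg_cong[OF trans[OF s[OF that(1)] s[OF that(2), symmetric]], of "\<lambda>l. l ! k"] that(3)
      by simp
    then show "\<forall>p\<in>A. \<forall>q\<in>A. \<forall>k<n. p k = q k" by blast
  next
    assume *: "\<forall>p\<in>A. \<forall>q\<in>A. \<forall>k<n. p k = q k"
    show "\<exists>s :: bool list. length s = n \<and> (\<forall>a\<in>A. map a [0..<n] = s)"
    proof (cases "A = {}")
      case True
      then show ?thesis using Ex_list_of_length by simp
    next
      case False
      then obtain q where "q \<in> A" by blast
      with * have "map a [0..<n] = map q [0..<n]" if "a \<in> A" for a
        using that by auto
      then show ?thesis by (intro exI[of _ "map q [0..<n]"]) simp
    qed
  qed
  then show ?thesis by (simp add: stem_length_def)
qed

lemma stem_length_eqI:
  assumes "\<And>p q k. p \<in> A \<Longrightarrow> q \<in> A \<Longrightarrow> k < l \<Longrightarrow> p k = q k"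
    and "p \<in> A" "q \<in> A" "p l \<noteq> q l"
  shows "stem_length A = l"
  unfolding stem_length_alt
proof (rule Greatest_equality)
  show "\<forall>p\<in>A. \<forall>q\<in>A. \<forall>k<l. p k = q k" using assms(1) by blast
next
  fix n assume "\<forall>p\<in>A. \<forall>q\<in>A. \<forall>k<n. p k = q k"
  with assms(2-4) show "n \<le> l" by (meson not_le)
qed

text \<open>A position where \<open>r\<close> and \<open>s\<close> differ bounds the lengths of
  common initial segments, and length 0 always qualifies, so the \<open>GREATEST\<close> in
  \<open>stem_length\<close> is attained.\<close>

lemma eq_below_stem_length:
  assumes "r \<in> A" "s \<in> A" "r \<noteq> s" "p \<in> A" "q \<in> A" "k < stem_length A"
  shows "p k = q k"
proof -
  let ?P = "\<lambda>n. \<forall>p\<in>A. \<forall>q\<in>A. \<forall>k<n. p k = q k"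
  obtain j where j: "r j \<noteq> s j" using assms(3) by blast
  have "\<And>n. ?P n \<Longrightarrow> n \<le> j" using assms(1,2) j by (meson not_le)
  then have "?P (stem_length A)"
    unfolding stem_length_alt by (intro GreatestI_nat[of ?P 0 j]) auto
  with assms(4-6) show ?thesis by blast
qed

section \<open>Initial sets\<close>

lemma IS_lessThan: "{..<i} \<in> IS"
  by (auto simp: IS_def)

lemma IS_Int: "\<xi> \<in> IS \<Longrightarrow> \<eta> \<in> IS \<Longrightarrow> \<xi> \<inter> \<eta> \<in> IS"
  by (auto simp: IS_def)

text \<open>Each disagreement at \<open>n\<close> removes the cone above \<open>\<Phi> n\<close>.
  This turns (S2) and (S3) into statements about the bits of two branches.\<close>

lemma xi_map:
  "xi \<Phi> (map a [0..<m]) (map b [0..<m]) = {j. \<forall>n<m. \<Phi> n \<le> j \<longrightarrow> a n = b n}"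
  by (induction m) (auto simp: less_Suc_eq)

section \<open>Matching the fibres of two admissible functions\<close>

lemma card_less_enumerate:
  fixes S :: "nat set"
  assumes "infinite S"
  shows "card {k \<in> S. k < enumerate S j} = j"
proof -
  have "{k \<in> S. k < enumerate S j} = enumerate S ` {..<j}"
  proof (intro equalityI subsetI)
    fix k assume k: "k \<in> {k \<in> S. k < enumerate S j}"
    then obtain l where l: "enumerate S l = k" using enumerate_Ex[OF assms, of k] by blast
    with k assms have "l < j" by auto
    with l show "k \<in> enumerate S ` {..<j}" by auto
  next
    fix k assume "k \<in> enumerate S ` {..<j}"
    with assms show "k \<in> {k \<in> S. k < enumerate S j}" by (auto simp: enumerate_in_set)
  qed
  then show ?thesis
    using inj_enumerate[OF assms] by (simp add: card_image inj_on_subset)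
qed

lemma enumerate_card_less:
  fixes S :: "nat set"
  assumes "infinite S" "n \<in> S"
  shows "enumerate S (card {k \<in> S. k < n}) = n"
proof -
  from assms(2) obtain j where "enumerate S j = n" using enumerate_Ex[OF assms] by blast
  with card_less_enumerate[OF assms(1), of j] show ?thesis by simp
qed

text \<open>The member of index \<open>j\<close> in the fibre of \<open>\<Psi>\<close> over
  \<open>i\<close> goes to the member of index \<open>j\<close> in the fibre of
  \<open>\<Phi>\<close> over \<open>i\<close>. The last clause, a form of monotonicity on fibres,
  says that when bit \<open>\<tau> m\<close> is read, all earlier bits of its fibre have been read;
  \<open>Spl_image\<close> asks for this.\<close>

lemma ex_fibre_matching:
  fixes \<Phi> \<Psi> :: "nat \<Rightarrow> 'i"
  assumes inf: "\<And>i. infinite {n. \<Phi> n = i}" "\<And>i. infinite {n. \<Psi> n = i}"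
  shows "\<exists>\<tau>. bij \<tau> \<and> (\<forall>m. \<Phi> (\<tau> m) = \<Psi> m) \<and>
    (\<forall>m k. k < \<tau> m \<longrightarrow> \<Phi> k = \<Psi> m \<longrightarrow> k \<in> \<tau> ` {..<m})"
proof -
  define A where "A = (\<lambda>i. {n. \<Phi> n = i})"
  define B where "B = (\<lambda>i. {n. \<Psi> n = i})"
  have infA: "infinite (A i)" and infB: "infinite (B i)" for i
    using inf by (simp_all add: A_def B_def)
  \<comment> \<open>The cardinality is the index of \<open>m\<close> within its own fibre, counted
    from 0.\<close>
  define \<tau> where "\<tau> = (\<lambda>m. enumerate (A (\<Psi> m)) (card {k \<in> B (\<Psi> m). k < m}))"
  have enum_B: "\<Psi> (enumerate (B i) j) = i" for i j
    using enumerate_in_set[OF infB, of i j] by (simp add: B_def)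
  have \<tau>_enum: "\<tau> (enumerate (B i) j) = enumerate (A i) j" for i j
    by (simp add: \<tau>_def enum_B card_less_enumerate infB)
  have ex_B: "\<exists>j. m = enumerate (B (\<Psi> m)) j" for m
    using enumerate_Ex[OF infB, of m "\<Psi> m"] unfolding B_def by (simp add: eq_commute)
  have ex_A: "\<exists>j. k = enumerate (A (\<Phi> k)) j" for k
    using enumerate_Ex[OF infA, of k "\<Phi> k"] unfolding A_def by (simp add: eq_commute)
  have \<Phi>\<tau>: "\<Phi> (\<tau> m) = \<Psi> m" for m
    using enumerate_in_set[OF infA, of "\<Psi> m"] by (simp add: \<tau>_def A_def)
  have before: "k \<in> \<tau> ` {..<m}" if less: "k < \<tau> m" and eq: "\<Phi> k = \<Psi> m" for k m
  proof -
    obtain J where J: "m = enumerate (B (\<Psi> m)) J" using ex_B by blast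
    obtain j where j: "k = enumerate (A (\<Psi> m)) j" using ex_A[of k] eq by auto
    have "\<tau> m = enumerate (A (\<Psi> m)) J" using \<tau>_enum[of "\<Psi> m" J] J by simp
    with less j infA have "j < J" by simp
    then have "enumerate (B (\<Psi> m)) j < enumerate (B (\<Psi> m)) J" using infB by simp
    with J have "enumerate (B (\<Psi> m)) j < m" by simp
    then show ?thesis using \<tau>_enum[of "\<Psi> m" j] j by (intro image_eqI) auto
  qed
  have "bij \<tau>"
  proof (rule bijI')
    fix m m' show "\<tau> m = \<tau> m' \<longleftrightarrow> m = m'"
    proof
      assume eq: "\<tau> m = \<tau> m'"
      then have \<Psi>: "\<Psi> m' = \<Psi> m" using \<Phi>\<tau> by metis
      obtain j where j: "m = enumerate (B (\<Psi> m)) j" using ex_B by blast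
      obtain j' where j': "m' = enumerate (B (\<Psi> m)) j'" using ex_B[of m'] \<Psi> by auto
      have "enumerate (A (\<Psi> m)) j = enumerate (A (\<Psi> m)) j'"
        using eq \<tau>_enum[of "\<Psi> m" j] \<tau>_enum[of "\<Psi> m" j'] j j' by simp
      then have "j = j'" using inj_enumerate[OF infA] by (simp add: inj_eq)
      with j j' show "m = m'" by simp
    qed simp
  next
    fix k
    obtain j where "k = enumerate (A (\<Phi> k)) j" using ex_A by blast
    then have "k = \<tau> (enumerate (B (\<Phi> k)) j)" using \<tau>_enum by simp
    then show "\<exists>m. k = \<tau> m" by (rule exI)
  qed
  with \<Phi>\<tau> before show ?thesis by (intro exI[of _ \<tau>] conjI allI impI)
qed

section \<open>Projection-keeping embeddings\<close>

text \<open>The bits \<open>a n\<close> with \<open>\<Phi> n = i\<close> play the role of coordinate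
  \<open>i\<close>. Equality is compared on the cones \<open>{..i}\<close>, the sets on which (S3)
  speaks.\<close>

locale projection_keeping =
  fixes \<Phi> :: "nat \<Rightarrow> 'i::order" and x :: "cantor \<Rightarrow> 'i \<Rightarrow> cantor"
  assumes continuous: "continuous_on UNIV x"
    and atMost_eq_iff: "(\<forall>j\<le>i. x a j = x b j) \<longleftrightarrow> (\<forall>n. \<Phi> n \<le> i \<longrightarrow> a n = b n)"
    and admissible: "admissible UNIV \<Phi>"
begin

text \<open>An initial set is the union of the cones \<open>{..i}\<close> of its members, so
  \<open>atMost_eq_iff\<close> extends to it.\<close>

lemma restrict_eq_iff:
  assumes "\<xi> \<in> IS"
  shows "restrict (x a) \<xi> = restrict (x b) \<xi> \<longleftrightarrow> (\<forall>n. \<Phi> n \<in> \<xi> \<longrightarrow> a n = b n)"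
proof
  assume *: "restrict (x a) \<xi> = restrict (x b) \<xi>"
  show "\<forall>n. \<Phi> n \<in> \<xi> \<longrightarrow> a n = b n"
  proof (intro allI impI)
    fix n assume "\<Phi> n \<in> \<xi>"
    with assms have "\<forall>j\<le>\<Phi> n. j \<in> \<xi>" by (auto simp: IS_def)
    with * have "\<forall>j\<le>\<Phi> n. x a j = x b j" by (metis restrict_apply')
    then show "a n = b n" unfolding atMost_eq_iff by simp
  qed
next
  assume *: "\<forall>n. \<Phi> n \<in> \<xi> \<longrightarrow> a n = b n"
  have "x a i = x b i" if "i \<in> \<xi>" for i
  proof -
    have "\<forall>n. \<Phi> n \<le> i \<longrightarrow> a n = b n" using * assms that by (auto simp: IS_def)
    with atMost_eq_iff[of i a b] show ?thesis by auto
  qed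
  then show "restrict (x a) \<xi> = restrict (x b) \<xi>" by auto
qed

lemma continuous_component: "continuous_on UNIV (\<lambda>a. x a i)"
  using continuous by (rule continuous_on_product_then_coordinatewise)

lemma continuous_map_restrict: "continuous_map euclidean (pow_top \<xi>) (\<lambda>a. restrict (x a) \<xi>)"
  using continuous_component by (auto simp: pow_top_def continuous_map_componentwise)

lemma section_at_range:
  "section_at (range x) (restrict (x a) {..<i}) i = (\<lambda>b. x b i) ` {b. \<forall>n. \<Phi> n < i \<longrightarrow> b n = a n}"
  using restrict_eq_iff[OF IS_lessThan, of _ i a] by (auto simp: section_at_def)

text \<open>The section is the continuous image of the compact set of branches with prescribed bits
  below \<open>i\<close>. No point is isolated, since infinitely many bits belong to
  \<open>i\<close> and one of them can be flipped arbitrarily late.\<close>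

lemma perfect_section: "perfect (section_at (range x) (restrict (x a) {..<i}) i)"
  unfolding perfect_def
proof (intro conjI ballI)
  let ?A = "{b. \<forall>n. \<Phi> n < i \<longrightarrow> b n = a n}"
  have "closed {b :: cantor. b n = a n}" for n
    using open_cantor_coordinate[of n "\<not> a n"] by (simp add: closed_def Collect_neg_eq[symmetric])
  then have "closed (\<Inter>n\<in>{n. \<Phi> n < i}. {b :: cantor. b n = a n})"
    by blast
  also have "(\<Inter>n\<in>{n. \<Phi> n < i}. {b :: cantor. b n = a n}) = ?A" by auto
  finally have "compact ?A"
    using compact_UNIV_cantor compact_Int_closed[of UNIV ?A] by simp
  then have "compact ((\<lambda>b. x b i) ` ?A)"
    using continuous_component continuous_on_subset by (blast intro: compact_continuous_image)
  then show "closed (section_at (range x) (restrict (x a) {..<i}) i)"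
    unfolding section_at_range by (rule compact_imp_closed_cantor)
next
  fix p assume "p \<in> section_at (range x) (restrict (x a) {..<i}) i"
  then obtain b where b: "\<And>n. \<Phi> n < i \<Longrightarrow> b n = a n" and p: "p = x b i"
    unfolding section_at_range by blast
  show "p islimpt section_at (range x) (restrict (x a) {..<i}) i"
  proof (rule islimptI)
    fix T :: "cantor set" assume T: "p \<in> T" "open T"
    have "open ((\<lambda>a. x a i) -` T)"
      using T(2) continuous_component by (rule open_vimage)
    moreover have "b \<in> (\<lambda>a. x a i) -` T" using T(1) p by simp
    ultimately obtain m where m: "{a. \<forall>n<m. a n = b n} \<subseteq> (\<lambda>a. x a i) -` T"
      by (rule open_contains_cylinder)
    have "infinite {n. \<Phi> n = i}" using admissible by (simp add: admissible_def)
    then obtain N where N: "N \<ge> m" "\<Phi> N = i"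
      unfolding infinite_nat_iff_unbounded_le by blast
    \<comment> \<open>The flipped bit lies beyond the cylinder, so \<open>x c i\<close> stays in
      \<open>T\<close>; it belongs to \<open>i\<close> itself, so all bits below \<open>i\<close>
      are kept.\<close>
    define c where "c = b(N := \<not> b N)"
    have "c \<in> {a. \<forall>n<m. a n = b n}" using N(1) by (simp add: c_def)
    with m have "c \<in> (\<lambda>a. x a i) -` T" by (rule subsetD)
    then have "x c i \<in> T" by simp
    moreover have c: "\<And>n. \<Phi> n < i \<Longrightarrow> c n = b n" using N(2) by (auto simp: c_def)
    \<comment> \<open>Equality at \<open>i\<close>, added to the agreement below \<open>i\<close>,
      would give agreement on the whole cone and hence at bit \<open>N\<close>.\<close>
    moreover have "x c i \<noteq> x b i"
    proof
      assume "x c i = x b i"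
      moreover have "restrict (x c) {..<i} = restrict (x b) {..<i}"
        unfolding restrict_eq_iff[OF IS_lessThan] using c by simp
      then have "x c j = x b j" if "j \<in> {..<i}" for j
        using that by (metis restrict_apply')
      ultimately have "\<forall>j\<le>i. x c j = x b j" by (auto simp: order_le_less)
      then have "c N = b N" unfolding atMost_eq_iff using N(2) by simp
      then show False by (simp add: c_def)
    qed
    moreover have "x c i \<in> section_at (range x) (restrict (x a) {..<i}) i"
      unfolding section_at_range using b c by (intro image_eqI[of _ _ c]) simp_all
    ultimately show "\<exists>y\<in>section_at (range x) (restrict (x a) {..<i}) i. y \<in> T \<and> y \<noteq> p"
      unfolding p by (intro bexI[of _ "x c i"] conjI)
  qed
qed

text \<open>The set in (P3) is the image \<open>r\<close>
  S\<open>of an open set of branches. If the saturation of\<close>S\<open>under\<close>r\<open>is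
  open, its complement is compact and has a closed image, which is the complement of\<close>r
  \<open>S\<close> within the projection.\<close>

lemma openin_restrict_range:
  assumes "open G"
  shows "openin (subtopology (pow_top {..<i}) (proj (range x) {..<i}))
    {restrict y {..<i} | y. y \<in> range x \<and> y i \<in> G}"
proof -
  define r where "r = (\<lambda>a. restrict (x a) {..<i})"
  have r_eq: "r a = r b \<longleftrightarrow> (\<forall>n. \<Phi> n < i \<longrightarrow> a n = b n)" for a b
    unfolding r_def restrict_eq_iff[OF IS_lessThan] by simp
  define S where "S = (\<lambda>a. x a i) -` G"
  have "open S"
    using assms continuous_component unfolding S_def by (rule open_vimage)
  \<comment> \<open>By \<open>r_eq\<close> this is the saturation of \<open>S\<close>: all branches
    with the same value of \<open>r\<close> as some branch in \<open>S\<close>.\<close>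
  define S' where "S' = {a. \<exists>b\<in>S. \<forall>n. \<Phi> n < i \<longrightarrow> a n = b n}"
  have "open S'"
    unfolding open_subopen[of S']
  proof
    fix a assume "a \<in> S'"
    then obtain b where b: "b \<in> S" "\<forall>n. \<Phi> n < i \<longrightarrow> a n = b n"
      unfolding S'_def by blast
    \<comment> \<open>Keeping the bits below \<open>i\<close> and taking all others from
      \<open>b\<close> is continuous, sends \<open>a\<close> to \<open>b\<close>, and does not
      change the value of \<open>r\<close>.\<close>
    define f where "f = (\<lambda>a n. if \<Phi> n < i then a n else b n :: bool)"
    have "continuous_on UNIV (\<lambda>a. f a n)" for n
      unfolding f_def by (cases "\<Phi> n < i") (simp_all add: continuous_on_cantor_coordinate)
    then have "continuous_on UNIV f"
      by (rule continuous_on_coordinatewise_then_product)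
    with \<open>open S\<close> have "open (f -` S)" by (rule open_vimage)
    moreover have "f a = b" by (rule ext) (simp add: f_def b(2))
    then have "a \<in> f -` S" using b(1) by simp
    moreover have "f -` S \<subseteq> S'"
    proof
      fix c assume "c \<in> f -` S"
      then have "f c \<in> S" by simp
      moreover have "\<forall>n. \<Phi> n < i \<longrightarrow> c n = f c n" by (simp add: f_def)
      ultimately have "\<exists>b\<in>S. \<forall>n. \<Phi> n < i \<longrightarrow> c n = b n" by (intro bexI[of _ "f c"])
      then show "c \<in> S'" by (simp add: S'_def)
    qed
    ultimately show "\<exists>T. open T \<and> a \<in> T \<and> T \<subseteq> S'" by blast
  qed
  then have "compact (- S')"
    using compact_UNIV_cantor compact_Int_closed[of UNIV "- S'"] by (simp add: closed_def)
  then have "compactin (pow_top {..<i}) (r ` (- S'))"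
    unfolding r_def by (intro image_compactin[OF _ continuous_map_restrict]) simp
  then have cl: "closedin (pow_top {..<i}) (r ` (- S'))"
    by (rule compactin_imp_closedin[OF Hausdorff_space_pow_top])
  have "{restrict y {..<i} | y. y \<in> range x \<and> y i \<in> G} = r ` S"
    by (auto simp: r_def S_def)
  also have "r ` S = (topspace (pow_top {..<i}) - r ` (- S')) \<inter> proj (range x) {..<i}"
  proof (intro equalityI subsetI)
    fix z assume "z \<in> r ` S"
    then obtain a where a: "a \<in> S" "z = r a" by (elim imageE)
    have "z \<notin> r ` (- S')"
    proof
      assume "z \<in> r ` (- S')"
      then obtain c where c: "z = r c" "c \<in> - S'" by (elim imageE)
      from a(2) c(1) have "r c = r a" by simp
      then have "\<exists>b\<in>S. \<forall>n. \<Phi> n < i \<longrightarrow> c n = b n"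
        unfolding r_eq using a(1) by (intro bexI[of _ a])
      then have "c \<in> S'" by (simp add: S'_def)
      with c(2) show False by simp
    qed
    moreover have "z \<in> topspace (pow_top {..<i})"
      by (simp add: a r_def pow_top_def)
    moreover have "z \<in> proj (range x) {..<i}"
      by (simp add: a r_def proj_def)
    ultimately show "z \<in> (topspace (pow_top {..<i}) - r ` (- S')) \<inter> proj (range x) {..<i}"
      by (intro IntI DiffI)
  next
    fix z assume z: "z \<in> (topspace (pow_top {..<i}) - r ` (- S')) \<inter> proj (range x) {..<i}"
    then have "z \<in> proj (range x) {..<i}" by (rule IntD2)
    then obtain a where a: "z = r a" by (auto simp: proj_def r_def)
    with z have "r a \<notin> r ` (- S')" by simp
    then have "a \<in> S'" using imageI[of a "- S'" r] by (metis ComplI)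
    then obtain b where "b \<in> S" and "\<forall>n. \<Phi> n < i \<longrightarrow> a n = b n"
      unfolding S'_def by blast
    then have "r a = r b" unfolding r_eq by simp
    with a \<open>b \<in> S\<close> show "z \<in> r ` S" by simp
  qed
  finally show ?thesis
    unfolding openin_subtopology using openin_diff[OF openin_topspace cl] by (intro exI conjI)
qed

text \<open>Amalgamation is done on branches: \<open>a\<close> and \<open>b\<close> agree on the
  bits belonging to both \<open>\<xi>\<close> and \<open>\<eta>\<close>, so one branch
  \<open>c\<close> can carry the bits of both.\<close>

lemma merge_restrict_range:
  assumes "\<xi> \<in> IS" "\<eta> \<in> IS" "y \<in> proj (range x) \<xi>" "z \<in> proj (range x) \<eta>"
    and eq: "restrict y (\<xi> \<inter> \<eta>) = restrict z (\<xi> \<inter> \<eta>)"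
  shows "merge \<xi> \<eta> (y, z) \<in> proj (range x) (\<xi> \<union> \<eta>)"
proof -
  from assms(3,4) obtain a b where y: "y = restrict (x a) \<xi>" and z: "z = restrict (x b) \<eta>"
    by (auto simp: proj_def)
  have "restrict (x a) (\<xi> \<inter> \<eta>) = restrict (x b) (\<xi> \<inter> \<eta>)"
    using eq by (simp add: y z Int_absorb1 Int_absorb2 Int_left_absorb)
  then have ab: "\<And>n. \<Phi> n \<in> \<xi> \<Longrightarrow> \<Phi> n \<in> \<eta> \<Longrightarrow> a n = b n"
    unfolding restrict_eq_iff[OF IS_Int[OF assms(1,2)]] by simp
  define c where "c = (\<lambda>n. if \<Phi> n \<in> \<xi> then a n else b n)"
  have "y = restrict (x c) \<xi>"
    unfolding y restrict_eq_iff[OF assms(1)] by (simp add: c_def)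
  moreover have "z = restrict (x c) \<eta>"
    unfolding z restrict_eq_iff[OF assms(2)] using ab by (simp add: c_def)
  ultimately have "merge \<xi> \<eta> (y, z) = restrict (x c) (\<xi> \<union> \<eta>)"
    by (simp add: merge_def restrict_def fun_eq_iff)
  then show ?thesis by (auto simp: proj_def)
qed

lemma range_in_Pprime: "range x \<in> Pprime UNIV"
proof -
  have "compact (range x)"
    using compact_UNIV_cantor continuous by (rule compact_continuous_image[rotated])
  then have "closedin (pow_top UNIV) (range x)"
    by (intro compactin_imp_closedin[OF Hausdorff_space_pow_top]) (simp add: pow_top_UNIV)
  moreover have "perfect (section_at (range x) z i)" if "z \<in> proj (range x) {..<i}" for z i
    using that perfect_section by (auto simp: proj_def)
  ultimately show ?thesis
    unfolding Pprime_def using openin_restrict_range merge_restrict_range by auto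
qed

end

section \<open>Splitting and shrinkability of the range\<close>

text \<open>Among branches sharing with \<open>b\<close> the bits before \<open>n\<close> and all
  bits below \<open>\<Phi> n\<close>, coordinate \<open>\<Phi> n\<close> is constant up to a
  position \<open>l\<close> and shows bit \<open>n\<close> at \<open>l\<close>. The position may
  depend on \<open>n\<close> and \<open>b\<close>.\<close>

locale splitting_embedding = projection_keeping +
  assumes split: "\<exists>l. \<forall>c. (\<forall>k<n. c k = b k) \<and> (\<forall>k. \<Phi> k < \<Phi> n \<longrightarrow> c k = b k) \<longrightarrow>
    x c (\<Phi> n) l = c n \<and> (\<forall>j<l. x c (\<Phi> n) j = x b (\<Phi> n) j)"
begin

text \<open>\<open>T\<close> holds the bits fixed so far. Over a fixed restriction below
  \<open>i\<close>, the earlier bits of the fibre are fixed by \<open>T\<close>, and bits not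
  belonging to \<open>{..i}\<close> do not influence coordinate \<open>i\<close>. So
  \<open>split\<close> applies to the whole section, whose stem ends exactly where bit
  \<open>n\<close> is shown.\<close>

lemma Spl_image:
  assumes n: "n \<notin> T" and T: "\<And>k. k < n \<Longrightarrow> \<Phi> k = \<Phi> n \<Longrightarrow> k \<in> T"
  shows "Spl (x ` {b. \<forall>k\<in>T. b k = d k}) (\<Phi> n) e = x ` {b. (\<forall>k\<in>T. b k = d k) \<and> b n = e}"
proof -
  define i where "i = \<Phi> n"
  define Y where "Y = x ` {b. \<forall>k\<in>T. b k = d k}"
  have iff: "x b i \<in> Spl_set (section_at Y (restrict (x b) {..<i}) i) e \<longleftrightarrow> b n = e"
    if b: "\<forall>k\<in>T. b k = d k" for b
  proof -
    let ?A = "section_at Y (restrict (x b) {..<i}) i"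
    have in_A: "x c i \<in> ?A" if "\<forall>k\<in>T. c k = d k" "\<forall>k. \<Phi> k < i \<longrightarrow> c k = b k" for c
    proof -
      have "restrict (x c) {..<i} = restrict (x b) {..<i}"
        unfolding restrict_eq_iff[OF IS_lessThan] using that(2) by simp
      moreover have "x c \<in> Y" using that(1) by (simp add: Y_def)
      ultimately show ?thesis unfolding section_at_def by (intro CollectI exI[of _ "x c"] conjI refl)
    qed
    obtain l where l: "\<forall>c. (\<forall>k<n. c k = b k) \<and> (\<forall>k. \<Phi> k < i \<longrightarrow> c k = b k) \<longrightarrow>
        x c i l = c n \<and> (\<forall>j<l. x c i j = x b i j)"
      using split[of n b] unfolding i_def by (rule exE)
    have agree: "p j = x b i j" if "p \<in> ?A" "j < l" for p j
    proof -
      from that(1) obtain y where y: "p = y i" "y \<in> Y" "restrict y {..<i} = restrict (x b) {..<i}"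
        unfolding section_at_def by (elim CollectE exE conjE)
      from y(2) obtain c where "y = x c" "c \<in> {b. \<forall>k\<in>T. b k = d k}"
        unfolding Y_def by (rule imageE)
      with y have c: "\<forall>k\<in>T. c k = d k" "p = x c i"
        and eq: "restrict (x c) {..<i} = restrict (x b) {..<i}"
        by simp_all
      from eq have cb: "\<forall>k. \<Phi> k < i \<longrightarrow> c k = b k"
        unfolding restrict_eq_iff[OF IS_lessThan] by simp
      \<comment> \<open>bits at coordinates outside \<open>{..i}\<close> do not affect \<open>x c i\<close> and may be reset to those of \<open>b\<close>\<close>
      define c' where "c' = (\<lambda>k. if \<Phi> k \<le> i then c k else b k)"
      have "\<forall>j\<le>i. x c' j = x c j"
        unfolding atMost_eq_iff by (simp add: c'_def)
      then have "x c' i = x c i" by simp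
      moreover have "c' k = b k" if "k < n" for k
      proof (cases "\<Phi> k = i")
        case True
        with that T have "k \<in> T" by (simp add: i_def)
        with b c(1) True show ?thesis by (simp add: c'_def)
      next
        case False
        with cb show ?thesis by (simp add: c'_def)
      qed
      moreover have "\<forall>k. \<Phi> k < i \<longrightarrow> c' k = b k" using cb by (simp add: c'_def)
      ultimately show ?thesis using l[rule_format, of c'] that(2) c(2) by simp
    qed
    have b_l: "x b i l = b n" using l[rule_format, of b] by simp
    \<comment> \<open>Since \<open>n\<close> is outside \<open>T\<close> and belongs to
      \<open>i\<close>, the flipped branch still contributes to the section; it differs from
      \<open>b\<close> at \<open>l\<close>, so the stem is no longer than \<open>l\<close>.\<close>
    define c where "c = b(n := \<not> b n)"
    have c: "\<forall>k\<in>T. c k = d k" "\<forall>k. \<Phi> k < i \<longrightarrow> c k = b k"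
      using b n by (auto simp: c_def i_def)
    have "x c i l = c n" using l[rule_format, of c] c(2) by (simp add: c_def)
    then have "x b i l \<noteq> x c i l" by (simp add: b_l c_def)
    moreover have "x b i \<in> ?A" using in_A[of b] b by simp
    moreover have "p k = q k" if "p \<in> ?A" "q \<in> ?A" "k < l" for p q k
      using agree[OF that(1,3)] agree[OF that(2,3)] by simp
    ultimately have "stem_length ?A = l"
      using in_A[OF c] by (intro stem_length_eqI)
    then show ?thesis
      using in_A[of b] b by (simp add: Spl_set_def b_l)
  qed
  show ?thesis
    unfolding i_def[symmetric] Y_def[symmetric]
  proof (intro equalityI subsetI)
    fix y assume "y \<in> Spl Y i e"
    then have y: "y \<in> Y" "y i \<in> Spl_set (section_at Y (restrict y {..<i}) i) e"
      by (simp_all add: Spl_def)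
    from y(1) obtain b where "y = x b" "b \<in> {b. \<forall>k\<in>T. b k = d k}"
      unfolding Y_def by (rule imageE)
    with y(2) iff show "y \<in> x ` {b. (\<forall>k\<in>T. b k = d k) \<and> b n = e}" by simp
  next
    fix y assume "y \<in> x ` {b. (\<forall>k\<in>T. b k = d k) \<and> b n = e}"
    then obtain b where b: "y = x b" "b \<in> {b. (\<forall>k\<in>T. b k = d k) \<and> b n = e}"
      by (rule imageE)
    then have "y \<in> Y" by (simp add: Y_def)
    with b iff show "y \<in> Spl Y i e" by (simp add: Spl_def)
  qed
qed

lemma inj_x: "inj x"
proof (rule injI)
  fix a b assume "x a = x b"
  then have "a n = b n" for n using atMost_eq_iff[of "\<Phi> n" a b] by simp
  then show "a = b" by blast
qed

lemma shrinkable_range: "shrinkable UNIV (range x)"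
  unfolding shrinkable_def
proof (intro allI impI)
  fix \<Psi> :: "nat \<Rightarrow> 'a" and a :: cantor
  assume "admissible UNIV \<Psi>"
  with admissible have "\<And>i. infinite {n. \<Phi> n = i}" "\<And>i. infinite {n. \<Psi> n = i}"
    by (simp_all add: admissible_def)
  from ex_fibre_matching[OF this] obtain \<tau>
    where bij: "bij \<tau>" and \<Phi>\<tau>: "\<forall>m. \<Phi> (\<tau> m) = \<Psi> m"
      and \<tau>: "\<forall>m k. k < \<tau> m \<longrightarrow> \<Phi> k = \<Psi> m \<longrightarrow> k \<in> \<tau> ` {..<m}"
    by (elim exE conjE)
  \<comment> \<open>The branch whose bit \<open>\<tau> m\<close> is the choice \<open>a m\<close>
    made at step \<open>m\<close>.\<close>
  define d where "d = (\<lambda>k. a (inv \<tau> k))"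
  have d: "d (\<tau> m) = a m" for m using bij by (simp add: d_def bij_is_inj)
  have iter: "split_iter \<Psi> (range x) (map a [0..<m]) = x ` {b. \<forall>k\<in>\<tau> ` {..<m}. b k = d k}" for m
  proof (induction m)
    case (Suc m)
    have "\<tau> m \<notin> \<tau> ` {..<m}" using bij by (auto simp: bij_def inj_def)
    then have "Spl (x ` {b. \<forall>k\<in>\<tau> ` {..<m}. b k = d k}) (\<Phi> (\<tau> m)) (a m) =
        x ` {b. (\<forall>k\<in>\<tau> ` {..<m}. b k = d k) \<and> b (\<tau> m) = a m}"
      using \<tau> \<Phi>\<tau> by (intro Spl_image) simp_all
    then have "Spl (split_iter \<Psi> (range x) (map a [0..<m])) (\<Psi> m) (a m) =
        x ` {b. (\<forall>k\<in>\<tau> ` {..<m}. b k = d k) \<and> b (\<tau> m) = a m}"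
      using Suc.IH \<Phi>\<tau> by simp
    moreover have "(\<forall>k\<in>\<tau> ` {..<Suc m}. b k = d k) \<longleftrightarrow>
        (\<forall>k\<in>\<tau> ` {..<m}. b k = d k) \<and> b (\<tau> m) = a m" for b
      by (auto simp: lessThan_Suc d)
    ultimately show ?case by simp
  qed simp
  have "split_branch \<Psi> (range x) a = {x d}"
  proof (intro equalityI subsetI)
    fix y assume y: "y \<in> split_branch \<Psi> (range x) a"
    then have y_iter: "y \<in> x ` {b. \<forall>k\<in>\<tau> ` {..<m}. b k = d k}" for m
      unfolding split_branch_def iter by (rule INT_D) simp
    then obtain b where b: "y = x b" by auto
    have "b k = d k" for k
    proof -
      obtain m where m: "k = \<tau> m" using bij by (metis bij_pointE)
      \<comment> \<open>Each stage offers its own preimage of \<open>y\<close>; injectivity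
        identifies them all with \<open>b\<close>.\<close>
      from y_iter[of "Suc m"] obtain c where yc: "y = x c"
        and c: "c \<in> {b. \<forall>k\<in>\<tau> ` {..<Suc m}. b k = d k}"
        by (rule imageE)
      from b yc inj_x have "c = b" by (simp add: inj_eq)
      with c m show ?thesis by auto
    qed
    then have "b = d" by blast
    with b show "y \<in> {x d}" by simp
  next
    fix y assume "y \<in> {x d}"
    then show "y \<in> split_branch \<Psi> (range x) a"
      unfolding split_branch_def iter by simp
  qed
  then show "is_singleton (split_branch \<Psi> (range x) a)" by simp
qed

lemma range_in_PP: "range x \<in> PP UNIV"
  using range_in_Pprime shrinkable_range by (simp add: PP_def)

end

section \<open>Fusion sequences\<close>

locale fusion =
  fixes M :: "('i::{order, countable} \<Rightarrow> cantor) metric"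
    and \<Phi> :: "nat \<Rightarrow> 'i"
    and X :: "bool list \<Rightarrow> ('i \<Rightarrow> cantor) set"
  assumes topology: "mtopology_of M = pow_top UNIV"
    and complete: "mcomplete_of M"
    and admissible: "admissible UNIV \<Phi>"
    and fusion: "fusion_sequence M \<Phi> X"
begin

sublocale Metric_space "mspace M" "mdist M"
  by (rule Metric_space_mspace_mdist)

lemma mtopology_eq: "mtopology = euclidean"
  using topology by (simp add: mtopology_of_def pow_top_UNIV)

lemma mspace_UNIV: "mspace M = UNIV"
  using topspace_mtopology mtopology_eq by simp

lemma ex_diam_less: "e > 0 \<Longrightarrow> \<exists>m. \<forall>u. length u = m \<longrightarrow> diam M (X u) < e"
  using fusion by (simp add: fusion_sequence_def)

lemma splitting: "splitting_system \<Phi> m X"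
  using fusion by (simp add: fusion_sequence_def)

lemma X_Pprime: "X u \<in> Pprime UNIV"
  using splitting[of "length u"] by (simp add: splitting_system_def PP_def)

lemma X_nonempty: "X u \<noteq> {}"
  using X_Pprime[of u] by (simp add: Pprime_def)

lemma X_closed: "closed (X u)"
  using X_Pprime[of u] by (simp add: Pprime_def pow_top_UNIV)

lemma X_snoc: "X (u @ [e]) \<subseteq> Spl (X u) (\<Phi> (length u)) e"
  using splitting[of "Suc (length u)"] by (simp add: splitting_system_def)

lemma X_snoc_subset: "X (u @ [e]) \<subseteq> X u"
  using X_snoc[of u e] by (auto simp: Spl_def)

lemma proj_X_eq:
  "length u = length v \<Longrightarrow> proj (X u) (xi \<Phi> u v) = proj (X v) (xi \<Phi> u v)"
  using splitting[of "length u"] unfolding splitting_system_def by blast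

lemma proj_X_disjoint:
  "length u = length v \<Longrightarrow> i \<notin> xi \<Phi> u v \<Longrightarrow> proj (X u) {..i} \<inter> proj (X v) {..i} = {}"
  using splitting[of "length u"] unfolding splitting_system_def by blast

lemma X_antimono: "m \<le> n \<Longrightarrow> X (map a [0..<n]) \<subseteq> X (map a [0..<m])"
proof (induction n rule: dec_induct)
  case (step n)
  then show ?case using X_snoc_subset[of "map a [0..<n]" "a n"] by simp
qed simp

text \<open>Compactness of \<open>D^I\<close> bounds the metric, so the real supremum in
  \<open>diam\<close> is an upper bound.\<close>

lemma mdist_le_diam:
  assumes "y \<in> X u" "z \<in> X u"
  shows "mdist M y z \<le> diam M (X u)"
proof -
  have "compact (UNIV :: ('i \<Rightarrow> cantor) set)"
    by (intro compact_UNIV_fun compact_UNIV_cantor)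
  then have "mbounded UNIV"
    by (intro compactin_imp_mbounded) (simp add: mtopology_eq)
  then obtain B where "\<forall>y z. mdist M y z \<le> B"
    unfolding mbounded_alt by auto
  then have "bdd_above ((\<lambda>(y, z). mdist M y z) ` (X u \<times> X u))"
    by (intro bdd_aboveI2[of _ _ B]) (simp add: case_prod_unfold)
  then show ?thesis
    unfolding diam_def using cSUP_upper[of "(y, z)" "X u \<times> X u" "\<lambda>(y, z). mdist M y z"] assms
    by simp
qed

section \<open>The point of a branch\<close>

definition point :: "cantor \<Rightarrow> 'i \<Rightarrow> cantor" where
  "point a = (THE y. \<forall>m. y \<in> X (map a [0..<m]))"

text \<open>Cantor's intersection theorem for the decreasing nonempty closed sets along the branch;
  (S4) makes their diameters arbitrarily small.\<close>

lemma ex1_point: "\<exists>!y. \<forall>m. y \<in> X (map a [0..<m])"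
proof -
  let ?C = "\<lambda>m. X (map a [0..<m])"
  have "\<exists>n c. ?C n \<subseteq> mcball c e" if "e > 0" for e
  proof -
    from ex_diam_less[OF that] obtain n where n: "\<forall>u. length u = n \<longrightarrow> diam M (X u) < e"
      by (rule exE)
    obtain c where c: "c \<in> ?C n" using X_nonempty by blast
    have "?C n \<subseteq> mcball c e"
    proof
      fix y assume "y \<in> ?C n"
      with mdist_le_diam[OF c this] n[rule_format, of "map a [0..<n]"] show "y \<in> mcball c e"
        unfolding in_mcball using mspace_UNIV by simp
    qed
    then show ?thesis by (intro exI)
  qed
  moreover have "decseq ?C"
    using X_antimono by (auto simp: decseq_def)
  moreover have "closedin mtopology (?C m)" for m
    using X_closed by (simp add: mtopology_eq)
  moreover have "mcomplete" using complete by (simp add: mcomplete_of_def)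
  ultimately obtain l where "\<Inter> (range ?C) = {l}"
    using X_nonempty unfolding mcomplete_nest_sing by meson
  then have "(\<forall>m. y \<in> ?C m) \<longleftrightarrow> y = l" for y
    by (simp add: set_eq_iff)
  then show ?thesis by simp
qed

lemma point_in_X: "point a \<in> X (map a [0..<m])"
  using theI'[OF ex1_point[of a]] unfolding point_def by simp

lemma point_unique: "(\<And>m. y \<in> X (map a [0..<m])) \<Longrightarrow> y = point a"
  using ex1_point[of a] point_in_X[of a] by (auto elim: ex1E)

lemma ex_X_subset_open:
  assumes "open U" "point a \<in> U"
  obtains m where "X (map a [0..<m]) \<subseteq> U"
proof -
  have "openin mtopology U" using assms(1) by (simp add: mtopology_eq)
  with assms(2) obtain r where r: "r > 0" "mball (point a) r \<subseteq> U"
    unfolding openin_mtopology by auto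
  from ex_diam_less[OF r(1)] obtain m where m: "\<forall>u. length u = m \<longrightarrow> diam M (X u) < r"
    by (rule exE)
  have "X (map a [0..<m]) \<subseteq> mball (point a) r"
  proof
    fix y assume "y \<in> X (map a [0..<m])"
    with mdist_le_diam[OF point_in_X this] m[rule_format, of "map a [0..<m]"] show "y \<in> mball (point a) r"
      unfolding in_mball using mspace_UNIV by simp
  qed
  from subset_trans[OF this r(2)] show ?thesis by (rule that)
qed

lemma X_cylinder: "\<forall>n<m. a n = b n \<Longrightarrow> X (map a [0..<m]) = X (map b [0..<m])"
  by (intro arg_cong[of _ _ X] map_cong) simp_all

lemma continuous_point: "continuous_on UNIV point"
  unfolding continuous_on_open_vimage[OF open_UNIV]
proof (intro allI impI)
  fix U :: "('i \<Rightarrow> cantor) set" assume U: "open U"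
  have "\<exists>T. open T \<and> a \<in> T \<and> T \<subseteq> point -` U" if "a \<in> point -` U" for a
  proof -
    from that have "point a \<in> U" by simp
    with U obtain m where m: "X (map a [0..<m]) \<subseteq> U" by (rule ex_X_subset_open)
    have "{b. \<forall>n<m. b n = a n} \<subseteq> point -` U"
    proof
      fix b assume "b \<in> {b. \<forall>n<m. b n = a n}"
      then have "X (map b [0..<m]) = X (map a [0..<m])" by (intro X_cylinder) simp
      with m point_in_X[of b m] show "b \<in> point -` U" by auto
    qed
    then show ?thesis
      by (intro exI[of _ "{b. \<forall>n<m. b n = a n}"] conjI open_cylinder) simp_all
  qed
  then have "open (point -` U)" unfolding open_subopen[of "point -` U"] by (intro ballI)
  then show "open (point -` U \<inter> UNIV)" by simp
qed

text \<open>If the values differ in bit \<open>k\<close>, some \<open>X (map b [0..<m])\<close> is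
  small enough to fix that bit at \<open>i\<close>. By (S2) it has a member agreeing with
  \<open>point a\<close> on a set containing \<open>i\<close>, a contradiction.\<close>

lemma point_eqI:
  assumes eq: "\<forall>n. \<Phi> n \<le> i \<longrightarrow> a n = b n"
  shows "point a i = point b i"
proof (rule ccontr)
  assume ne: "point a i \<noteq> point b i"
  then obtain k where k: "point a i k \<noteq> point b i k" by blast
  have "open ((\<lambda>y. y i) -` {p :: cantor. p k = point b i k} :: ('i \<Rightarrow> cantor) set)"
    by (intro open_vimage open_cantor_coordinate continuous_on_product_coordinates)
  moreover have "point b \<in> (\<lambda>y. y i) -` {p. p k = point b i k}" by simp
  ultimately obtain m where m: "X (map b [0..<m]) \<subseteq> (\<lambda>y. y i) -` {p. p k = point b i k}"
    by (rule ex_X_subset_open)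
  let ?\<xi> = "xi \<Phi> (map a [0..<m]) (map b [0..<m])"
  have i: "i \<in> ?\<xi>" using eq by (simp add: xi_map)
  have "restrict (point a) ?\<xi> \<in> proj (X (map a [0..<m])) ?\<xi>"
    unfolding proj_def by (intro imageI point_in_X)
  also have "\<dots> = proj (X (map b [0..<m])) ?\<xi>"
    by (rule proj_X_eq) simp
  finally obtain y where y: "restrict (point a) ?\<xi> = restrict y ?\<xi>" "y \<in> X (map b [0..<m])"
    unfolding proj_def by (rule imageE)
  from fun_cong[OF y(1), of i] i have "point a i = y i" by simp
  with m y(2) k show False by auto
qed

lemma point_atMost_eq_iff:
  "(\<forall>j\<le>i. point a j = point b j) \<longleftrightarrow> (\<forall>n. \<Phi> n \<le> i \<longrightarrow> a n = b n)"
proof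
  assume eq: "\<forall>j\<le>i. point a j = point b j"
  show "\<forall>n. \<Phi> n \<le> i \<longrightarrow> a n = b n"
  proof (intro allI impI)
    fix n assume n: "\<Phi> n \<le> i"
    \<comment> \<open>Length \<open>Suc n\<close> is the first that includes bit \<open>n\<close>; a
      difference there already removes \<open>i\<close> from \<open>xi\<close>, so (S3)
      applies.\<close>
    let ?u = "map a [0..<Suc n]" and ?v = "map b [0..<Suc n]"
    show "a n = b n"
    proof (rule ccontr)
      assume "a n \<noteq> b n"
      with n have "i \<notin> xi \<Phi> ?u ?v" by (simp only: xi_map) auto
      then have "proj (X ?u) {..i} \<inter> proj (X ?v) {..i} = {}"
        by (intro proj_X_disjoint) simp_all
      moreover have "restrict (point a) {..i} \<in> proj (X ?u) {..i}"
        unfolding proj_def by (intro imageI point_in_X)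
      moreover have "restrict (point b) {..i} \<in> proj (X ?v) {..i}"
        unfolding proj_def by (intro imageI point_in_X)
      moreover have "restrict (point a) {..i} = restrict (point b) {..i}"
        using eq by (intro restrict_ext) simp
      ultimately show False by auto
    qed
  qed
next
  assume eq: "\<forall>n. \<Phi> n \<le> i \<longrightarrow> a n = b n"
  show "\<forall>j\<le>i. point a j = point b j"
  proof (intro allI impI point_eqI)
    fix j n assume "j \<le> i" "\<Phi> n \<le> j"
    with eq show "a n = b n" using order_trans by blast
  qed
qed

sublocale projection_keeping \<Phi> point
  by unfold_locales (rule continuous_point point_atMost_eq_iff admissible)+

lemma point_Spl:
  "point c \<in> Spl (X (map c [0..<n])) (\<Phi> n) (c n)"
  using X_snoc[of "map c [0..<n]" "c n"] point_in_X[of c "Suc n"] by auto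

text \<open>
  The splitting position \<open>l\<close> is the stem length of the section of \<open>X (map b [0..<n])\<close> at \<open>\<Phi> n\<close>: this
  section contains all \<open>point c (\<Phi> n)\<close> in question, and (S1) puts each into the half given by \<open>c n\<close>.
\<close>

lemma point_split:
  "\<exists>l. \<forall>c. (\<forall>k<n. c k = b k) \<and> (\<forall>k. \<Phi> k < \<Phi> n \<longrightarrow> c k = b k) \<longrightarrow>
    point c (\<Phi> n) l = c n \<and> (\<forall>j<l. point c (\<Phi> n) j = point b (\<Phi> n) j)"
proof -
  define A where "A = section_at (X (map b [0..<n])) (restrict (point b) {..<\<Phi> n}) (\<Phi> n)"
  have A: "point c (\<Phi> n) \<in> A \<and> point c (\<Phi> n) (stem_length A) = c n"
    if c: "\<forall>k<n. c k = b k" "\<forall>k. \<Phi> k < \<Phi> n \<longrightarrow> c k = b k" for c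
  proof -
    have "restrict (point c) {..<\<Phi> n} = restrict (point b) {..<\<Phi> n}"
      unfolding restrict_eq_iff[OF IS_lessThan] using c(2) by simp
    with point_Spl[of c n] X_cylinder[OF c(1)]
    have "point c (\<Phi> n) \<in> Spl_set A (c n)"
      by (simp add: Spl_def A_def)
    then show ?thesis by (simp add: Spl_set_def)
  qed
  \<comment> \<open>Flipping bit \<open>n\<close> keeps the bits before \<open>n\<close> and those
    below \<open>\<Phi> n\<close>. This gives \<open>A\<close> a second point, so that its stem
    length is meaningful.\<close>
  define d where "d = b(n := \<not> b n)"
  have b: "point b (\<Phi> n) \<in> A" "point b (\<Phi> n) (stem_length A) = b n"
    using A[of b] by simp_all
  have d: "point d (\<Phi> n) \<in> A" "point d (\<Phi> n) (stem_length A) = (\<not> b n)"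
    using A[of d] by (simp_all add: d_def)
  from b(2) d(2) have "point b (\<Phi> n) \<noteq> point d (\<Phi> n)" by auto
  note below = eq_below_stem_length[OF b(1) d(1) this _ b(1)]
  show ?thesis
  proof (intro exI[of _ "stem_length A"] allI impI conjI)
    fix c assume "(\<forall>k<n. c k = b k) \<and> (\<forall>k. \<Phi> k < \<Phi> n \<longrightarrow> c k = b k)"
    with A[of c] have c: "point c (\<Phi> n) \<in> A" "point c (\<Phi> n) (stem_length A) = c n"
      by simp_all
    show "point c (\<Phi> n) (stem_length A) = c n" by (rule c(2))
    fix j assume "j < stem_length A"
    with c(1) show "point c (\<Phi> n) j = point b (\<Phi> n) j" by (rule below)
  qed
qed

sublocale splitting_embedding \<Phi> point
  by unfold_locales (rule point_split)

section \<open>The fusion set as the range of \<open>point\<close>\<close>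

text \<open>Where \<open>u\<close> and \<open>v\<close> first are seen to differ, at some
  \<open>n\<close>, the index \<open>\<Phi> n\<close> is outside \<open>xi \<Phi> u v\<close>, and
  (S3) separates the two sets.\<close>

lemma X_disjoint:
  assumes "length u = length v" "y \<in> X u" "y \<in> X v"
  shows "u = v"
proof (rule ccontr)
  assume "u \<noteq> v"
  with assms(1) obtain n where n: "n < length u" "u ! n \<noteq> v ! n"
    by (auto simp: list_eq_iff_nth_eq)
  \<comment> \<open>The lists are rewritten as maps of their own \<open>nth\<close> functions, the
    form that \<open>xi_map\<close> treats.\<close>
  have "xi \<Phi> u v = {j. \<forall>n<length u. \<Phi> n \<le> j \<longrightarrow> u ! n = v ! n}"
    using xi_map[of \<Phi> "(!) u" "length u" "(!) v"]
    by (simp only: map_nth map_nth[of v, folded assms(1)])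
  with n have "\<Phi> n \<notin> xi \<Phi> u v" by auto
  with assms(1) have "proj (X u) {..\<Phi> n} \<inter> proj (X v) {..\<Phi> n} = {}"
    by (intro proj_X_disjoint)
  moreover have "restrict y {..\<Phi> n} \<in> proj (X u) {..\<Phi> n}" "restrict y {..\<Phi> n} \<in> proj (X v) {..\<Phi> n}"
    using assms(2,3) by (simp_all add: proj_def)
  ultimately show False by auto
qed

text \<open>Sets on one level are disjoint, so the sequences \<open>U m\<close> locating
  \<open>y\<close> on the different levels extend one another and form a single branch.\<close>

lemma Inter_Union_X: "(\<Inter>m. \<Union>u\<in>{u. length u = m}. X u) = range point"
proof (intro equalityI subsetI)
  fix y assume "y \<in> (\<Inter>m. \<Union>u\<in>{u. length u = m}. X u)"
  then have "\<forall>m. \<exists>u. length u = m \<and> y \<in> X u" by auto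
  then obtain U where U: "\<And>m. length (U m) = m" "\<And>m. y \<in> X (U m)"
    by metis
  have U_Suc: "U (Suc m) = U m @ [last (U (Suc m))]" for m
  proof -
    have "U (Suc m) \<noteq> []" using U(1)[of "Suc m"] by auto
    then have eq: "U (Suc m) = butlast (U (Suc m)) @ [last (U (Suc m))]" by simp
    have "y \<in> X (butlast (U (Suc m)))"
      using U(2)[of "Suc m"] eq X_snoc_subset by (metis subsetD)
    then have "butlast (U (Suc m)) = U m"
      using U by (intro X_disjoint) simp_all
    with eq show ?thesis by simp
  qed
  \<comment> \<open>Bit \<open>m\<close> is the entry by which \<open>U (Suc m)\<close> extends
    \<open>U m\<close>.\<close>
  define a where "a = (\<lambda>m. last (U (Suc m)))"
  have "U m = map a [0..<m]" for m
  proof (induction m)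
    case 0
    show ?case using U(1)[of 0] by simp
  next
    case (Suc m)
    then show ?case using U_Suc[of m] by (simp add: a_def)
  qed
  with U(2) have "y = point a" by (intro point_unique) metis
  then show "y \<in> range point" by simp
next
  fix y assume "y \<in> range point"
  then obtain a where "y = point a" by (rule imageE)
  then have "y \<in> X (map a [0..<m])" for m by (simp add: point_in_X)
  then have "\<exists>u\<in>{u. length u = m}. y \<in> X u" for m
    by (intro bexI[of _ "map a [0..<m]"]) simp_all
  then show "y \<in> (\<Inter>m. \<Union>u\<in>{u. length u = m}. X u)" by simp
qed

end

theorem theorem4:
  fixes M :: "('i::{order, countable} \<Rightarrow> cantor) metric"
    and \<Phi> :: "nat \<Rightarrow> 'i"
    and X :: "bool list \<Rightarrow> ('i \<Rightarrow> cantor) set"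
  assumes "mtopology_of M = pow_top UNIV"
    and "mcomplete_of M"
    and "admissible UNIV \<Phi>"
    and "fusion_sequence M \<Phi> X"
  shows "(\<Inter>m. \<Union>u\<in>{u. length u = m}. X u) \<in> PP UNIV"
proof -
  interpret fusion M \<Phi> X using assms by unfold_locales
  show ?thesis unfolding Inter_Union_X by (rule range_in_PP)
qed

end
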